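(* Let $\rho>0$, $\alpha\in(0,1)$, $T>0$, $A\in\mathbb{R}^{n\times n}$, $B\in\mathbb{R}^{n\times m}$, $C\in\mathbb{R}^{p\times n}$ and $D\in\mathbb{R}^{p\times m}$, and let $t_f\in(0,T]$. The tempered fractional linear system $$ {}^T D_0^{\alpha,\rho}y(t)=Ay(t)+Bu(t),\quad t\in[0,T],\qquad y(0)=y_0\in\mathbb{R}^n, $$ with output $$ z(t)=Cy(t)+Du(t)\in\mathbb{R}^p, $$ is observable on $[0,t_f]$ if, and only if, $$ \operatorname{rank} Q_o=\operatorname{rank}\begin{pmatrix} C\\ CA\\ \vdots\\ CA^{n-1}\end{pmatrix}=n. $$
   Context: For $\alpha\in(0,1)$ and $\rho>0$, the Caputo tempered fractional derivative of a function $v$ (a $C^1$ function; applied componentwise to vector-valued functions) is $$ {}^T D_0^{\alpha,\rho}v(t)=\frac{1}{\Gamma(1-\alpha)}\int_0^t e^{-\rho(t-s)}(t-s)^{-\alpha}\big(\rho v(s)+v'(s)\big)\,ds, $$ where $\Gamma$ is the Euler gamma function. The Mittag-Leffler functions of a square matrix $M$ are $E_\alpha(M)=\sum_{l=0}^{\infty}\frac{M^l}{\Gamma(\alpha l+1)}$ and $E_{\alpha,\alpha'}(M)=\sum_{l=0}^{\infty}\frac{M^l}{\Gamma(\alpha l+\alpha')}$, for $\alpha,\alpha'>0$. The solution of the system associated with an input $u:[0,T]\to\mathbb{R}^m$ and an initial state $y_0$ is given by $$ y(t)=e^{-\rho t}E_\alpha(At^\alpha)y_0+\int_0^t e^{-\rho(t-\tau)}(t-\tau)^{\alpha-1}E_{\alpha,\alpha}\big(A(t-\tau)^\alpha\big)Bu(\tau)\,d\tau.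 $$ Definition (observability): the system with output is (state) observable on $[0,t_f]$ if any initial condition $y(0)=y_0\in\mathbb{R}^n$ is uniquely determined by the associated system input $u(t)$ and output $z(t)$, $t\in[0,t_f]$. *)

theory Defs
  imports "HOL-Analysis.Analysis"
begin

text \<open>The library powers on \<open>real ^ 'n ^ 'n\<close> are componentwise, so the powers of a square
  matrix with respect to the matrix product are introduced separately.\<close>

primrec matpow :: "real ^ 'n ^ 'n \<Rightarrow> nat \<Rightarrow> real ^ 'n ^ 'n" where
  "matpow M 0 = mat 1"
| "matpow M (Suc k) = M ** matpow M k"

definition mittag_leffler2 :: "real \<Rightarrow> real \<Rightarrow> real ^ 'n ^ 'n \<Rightarrow> real ^ 'n ^ 'n" where
  "mittag_leffler2 \<alpha> \<beta> M = (\<Sum>l. (1 / Gamma (\<alpha> * real l + \<beta>)) *\<^sub>R matpow M l)"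

definition mittag_leffler :: "real \<Rightarrow> real ^ 'n ^ 'n \<Rightarrow> real ^ 'n ^ 'n" where
  "mittag_leffler \<alpha> M = mittag_leffler2 \<alpha> 1 M"

definition tempered_caputo ::
  "real \<Rightarrow> real \<Rightarrow> (real \<Rightarrow> real ^ 'n) \<Rightarrow> real \<Rightarrow> real ^ 'n" where
  "tempered_caputo \<alpha> \<rho> v t =
     (1 / Gamma (1 - \<alpha>)) *\<^sub>R
     integral {0..t} (\<lambda>s. (exp (- \<rho> * (t - s)) * (t - s) powr (- \<alpha>)) *\<^sub>R
                          (\<rho> *\<^sub>R v s + vector_derivative v (at s)))"

text \<open>Solutions of the initial value problem in the sense of the fractional differential equation.
  Solutions behave like \<open>y0 + c t powr \<alpha>\<close> near \<open>0\<close>, so they are in general not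
  differentiable at \<open>0\<close>: they are required to be continuous on \<open>[0,T]\<close> and \<open>C\<^sup>1\<close> on \<open>(0,T]\<close> with
  integrable derivative.  At \<open>t = 0\<close> the derivative is an integral over a null set, and the
  equation would degenerate to \<open>A y0 + B u(0) = 0\<close>; it is therefore imposed on \<open>(0,T]\<close>.\<close>

definition equation_solution ::
  "real \<Rightarrow> real \<Rightarrow> real \<Rightarrow> real ^ 'n ^ 'n \<Rightarrow> real ^ 'm ^ 'n \<Rightarrow>
   (real \<Rightarrow> real ^ 'm) \<Rightarrow> real ^ 'n \<Rightarrow> (real \<Rightarrow> real ^ 'n) \<Rightarrow> bool" where
  "equation_solution \<alpha> \<rho> T A B u y0 y \<longleftrightarrow>
     continuous_on {0..T} y \<and>
     (\<exists>y'. (\<forall>t\<in>{0<..T}. (y has_vector_derivative y' t) (at t within {0..T})) \<and>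
           continuous_on {0<..T} y' \<and> y' absolutely_integrable_on {0..T}) \<and>
     (\<forall>t\<in>{0<..T}. tempered_caputo \<alpha> \<rho> y t = A *v y t + B *v u t) \<and>
     y 0 = y0"

text \<open>Solutions given by the variation-of-constants formula.  This makes sense for every input for
  which the integrals exist, also when the resulting trajectory is not \<open>C\<^sup>1\<close> on \<open>(0,T]\<close>.\<close>

definition formula_solution ::
  "real \<Rightarrow> real \<Rightarrow> real \<Rightarrow> real ^ 'n ^ 'n \<Rightarrow> real ^ 'm ^ 'n \<Rightarrow>
   (real \<Rightarrow> real ^ 'm) \<Rightarrow> real ^ 'n \<Rightarrow> (real \<Rightarrow> real ^ 'n) \<Rightarrow> bool" where
  "formula_solution \<alpha> \<rho> T A B u y0 y \<longleftrightarrow>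
     (\<forall>t\<in>{0..T}.
        let k = (\<lambda>\<tau>. (exp (- \<rho> * (t - \<tau>)) * (t - \<tau>) powr (\<alpha> - 1)) *\<^sub>R
                     (mittag_leffler2 \<alpha> \<alpha> ((t - \<tau>) powr \<alpha> *\<^sub>R A) *v (B *v u \<tau>)))
        in k absolutely_integrable_on {0..t} \<and>
           y t = exp (- \<rho> * t) *\<^sub>R (mittag_leffler \<alpha> (t powr \<alpha> *\<^sub>R A) *v y0) + integral {0..t} k)"

text \<open>\<open>sol u y0 y\<close> says that \<open>y\<close> is a trajectory with input \<open>u\<close> and initial state \<open>y0\<close>.  Only the
  restrictions of input and output to \<open>[0,tf]\<close> may be used to recover \<open>y0\<close>.\<close>

definition observable_on ::
  "real \<Rightarrow> ((real \<Rightarrow> real ^ 'm) \<Rightarrow> real ^ 'n \<Rightarrow> (real \<Rightarrow> real ^ 'n) \<Rightarrow> bool) \<Rightarrow>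
   real ^ 'n ^ 'p \<Rightarrow> real ^ 'm ^ 'p \<Rightarrow> bool" where
  "observable_on tf sol C D \<longleftrightarrow>
     (\<forall>u1 u2 x1 x2 y1 y2.
        sol u1 x1 y1 \<and> sol u2 x2 y2 \<and>
        (\<forall>t\<in>{0..tf}. u1 t = u2 t) \<and>
        (\<forall>t\<in>{0..tf}. C *v y1 t + D *v u1 t = C *v y2 t + D *v u2 t) \<longrightarrow>
        x1 = x2)"

text \<open>Row \<open>(j, i)\<close> is row \<open>i\<close> of the block \<open>C A\<^sup>k\<close>, where \<open>k\<close> is the number of \<open>j\<close> in an
  enumeration of the index type \<open>'n\<close> by \<open>0, \<dots>, n - 1\<close>.\<close>

definition observability_matrix ::
  "real ^ 'n ^ 'n \<Rightarrow> real ^ 'n ^ 'p \<Rightarrow> real ^ 'n ^ ('n \<times> 'p)" where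
  "observability_matrix A C =
     (\<chi> r. (C ** matpow A (to_nat_on (UNIV :: 'n set) (fst r))) $ snd r)"

end

theory Submission
  imports Defs
begin

text \<open>Both notions of trajectory are linear in input and initial state, so observability says that a
  trajectory \<open>w\<close> with zero input and zero output on \<open>[0, tf]\<close> starts at \<open>0\<close>.  Full rank of the
  observability matrix is equivalent to the condition that \<open>C A\<^sup>k x = 0\<close> for all \<open>k\<close> implies \<open>x = 0\<close>
  (\<open>rank_observability_matrix_full_iff\<close>), and this is the form in which the rank is used.

  Sufficiency for the differential equation is a fractional version of differentiating the
  output.  Applying the tempered Caputo derivative to \<open>C w = 0\<close> gives \<open>C A w = 0\<close> on the same interval,
  and inductively \<open>C A\<^sup>k w = 0\<close> for all \<open>k\<close>; evaluation at time \<open>0\<close> gives the claim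
  (\<open>vanishing_output_propagates\<close>, \<open>equation_solution_initial_state_zero\<close>).

  The other parts use the free response \<open>w(t) = exp (- \<rho> t) E\<^sub>\<alpha>(A t\<^sup>\<alpha>) x\<close>, the trajectory of the formula
  for zero input.  It also solves the differential equation (\<open>free_response_equation_solution\<close>), by
  termwise integration of the Mittag-Leffler series, each term being a Beta integral.  For a state
  \<open>x\<close> with all \<open>C A\<^sup>k x = 0\<close> the output of the free response vanishes identically, which gives
  necessity for both notions of trajectory.  In the variation-of-constants formula the difference of
  two trajectories with the same input is a free response, so that sufficiency for the formula
  is reduced to sufficiency for the differential equation.\<close>

section \<open>The observability matrix\<close>

lemma matpow_scaleR: "matpow (z *\<^sub>R M) l = z ^ l *\<^sub>R matpow M l"
  by (induction l) (simp_all add: matrix_scalar_ac scalar_matrix_assoc[symmetric] mult_ac)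

lemma matpow_Suc_vector: "matpow M (Suc l) *v x = matpow M l *v (M *v x)"
proof (induction l)
  case (Suc l)
  then show ?case
    by (metis matpow.simps(2) matrix_vector_mul_assoc)
qed simp

lemma observability_matrix_mult_eq_0_iff:
  fixes A :: "real ^ 'n ^ 'n" and C :: "real ^ 'n ^ 'p"
  shows "observability_matrix A C *v x = 0 \<longleftrightarrow>
    (\<forall>k<CARD('n). C *v (matpow A k *v x) = 0)"
proof -
  have entry: "(observability_matrix A C *v x) $ r =
      (C *v (matpow A (to_nat_on (UNIV :: 'n set) (fst r)) *v x)) $ snd r" for r
    unfolding observability_matrix_def matrix_vector_mul_assoc
    by (simp add: matrix_vector_mult_def)
  have img: "to_nat_on (UNIV :: 'n set) ` UNIV = {..<CARD('n)}"
    using to_nat_on_finite[of "UNIV :: 'n set"] by (simp add: bij_betw_def)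
  have "observability_matrix A C *v x = 0 \<longleftrightarrow>
      (\<forall>j i. (C *v (matpow A (to_nat_on (UNIV :: 'n set) j) *v x)) $ i = 0)"
    by (simp add: vec_eq_iff entry)
  also have "\<dots> \<longleftrightarrow> (\<forall>k\<in>to_nat_on (UNIV :: 'n set) ` UNIV. C *v (matpow A k *v x) = 0)"
    by (simp add: vec_eq_iff)
  finally show ?thesis
    unfolding img by (simp add: Ball_def)
qed

text \<open>The spaces \<open>N m\<close> of states annihilated by \<open>C, C A, \<dots>, C A\<^sup>m\<^sup>-\<^sup>1\<close> decrease, so by dimension two
  consecutive ones among the first \<open>n + 2\<close> coincide; since \<open>N (m + 1)\<close> is determined by \<open>N m\<close> through
  \<open>A\<close>, the chain is constant from there on.\<close>

lemma unobservable_finite_imp_all: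
  fixes A :: "real ^ 'n ^ 'n" and C :: "real ^ 'n ^ 'p"
  assumes "\<forall>k<CARD('n). C *v (matpow A k *v x) = 0"
  shows "C *v (matpow A k *v x) = 0"
proof -
  define N where "N m = {x. \<forall>j<m. C *v (matpow A j *v x) = 0}" for m
  have sub: "subspace (N m)" for m
    unfolding N_def subspace_def
    by (auto simp: matrix_vector_right_distrib matrix_vector_mult_scaleR)
  have anti: "N (Suc m) \<subseteq> N m" for m
    unfolding N_def by auto
  have rec: "x \<in> N (Suc m) \<longleftrightarrow> C *v x = 0 \<and> A *v x \<in> N m" for x m
    unfolding N_def mem_Collect_eq All_less_Suc2 matpow_Suc_vector by simp
  \<comment> \<open>Otherwise each of the first \<open>n + 1\<close> steps would lower the dimension, starting from at most \<open>n\<close>.\<close>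
  have "\<exists>m\<le>CARD('n). N (Suc m) = N m"
  proof (rule ccontr)
    assume *: "\<not> (\<exists>m\<le>CARD('n). N (Suc m) = N m)"
    have "m \<le> Suc (CARD('n)) \<Longrightarrow> dim (N m) + m \<le> CARD('n)" for m
    proof (induction m)
      case 0
      then show ?case using dim_subset_UNIV_cart[of "N 0"] by simp
    next
      case (Suc m)
      with * anti have "N (Suc m) \<subset> N m" by auto
      then have "dim (N (Suc m)) < dim (N m)"
        by (intro dim_psubset) (simp add: span_eq_iff[THEN iffD2, OF sub])
      with Suc show ?case by simp
    qed
    from this[of "Suc (CARD('n))"] show False by simp
  qed
  then obtain m where m: "m \<le> CARD('n)" "N (Suc m) = N m" by blast
  have stable: "N (m + j) = N m" for j
  proof (induction j)
    case (Suc j)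
    then have "N (Suc (m + j)) = N (Suc m)"
      using rec by blast
    with m show ?case by simp
  qed simp
  have "x \<in> N (CARD('n))" using assms by (simp add: N_def)
  then have "x \<in> N m" using m(1) unfolding N_def by auto
  then have "x \<in> N (m + Suc k)" by (simp only: stable)
  then show ?thesis unfolding N_def by auto
qed

text \<open>Full column rank means trivial kernel, and the kernel is the space of states that no power
  of \<open>A\<close> makes visible through \<open>C\<close>.  The condition over all powers is the one that both directions of
  the observability theorem work with.\<close>

lemma rank_observability_matrix_full_iff:
  fixes A :: "real ^ 'n ^ 'n" and C :: "real ^ 'n ^ 'p"
  shows "rank (observability_matrix A C) = CARD('n) \<longleftrightarrow>
    (\<forall>x. (\<forall>k. C *v (matpow A k *v x) = 0) \<longrightarrow> x = 0)"
proof -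
  have "rank (observability_matrix A C) = CARD('n) \<longleftrightarrow>
      (\<forall>x. observability_matrix A C *v x = 0 \<longrightarrow> x = 0)"
    unfolding full_rank_injective
    by (simp add: linear_injective_0[OF matrix_vector_mul_linear])
  then show ?thesis
    unfolding observability_matrix_mult_eq_0_iff
    using unobservable_finite_imp_all[of C A] by blast
qed

section \<open>Growth of the Gamma function and a Beta integral\<close>

text \<open>Log-convexity of \<open>\<Gamma>\<close>: the slope of \<open>ln \<circ> \<Gamma>\<close> over \<open>[x, x + a]\<close> is at least the slope over
  \<open>[x - 1, x]\<close>, which is \<open>ln (x - 1)\<close> by the functional equation.\<close>

lemma Gamma_add_ge:
  fixes x a :: real
  assumes "x > 1" "a > 0"
  shows "(x - 1) powr a * Gamma x \<le> Gamma (x + a)"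
proof -
  define f where "f = (ln \<circ> Gamma :: real \<Rightarrow> real)"
  have f: "convex_on {0<..} f" unfolding f_def by (rule log_convex_Gamma_real)
  have pos: "Gamma (x - 1) > 0" "Gamma x > 0" "Gamma (x + a) > 0"
    using assms by (auto intro: Gamma_real_pos)
  have "Gamma x = (x - 1) * Gamma (x - 1)"
    using Gamma_plus1[of "x - 1"] nonpos_Ints_nonpos[of "x - 1"] assms by force
  then have ln: "f x - f (x - 1) = ln (x - 1)"
    using pos[THEN less_imp_neq] assms by (simp add: f_def ln_mult)
  have "(f (x - 1) - f x) / ((x - 1) - x) \<le> (f x - f (x + a)) / (x - (x + a))"
    using convex_on_slope_le[OF f, of "x - 1" "x + a" x] assms by simp
  then have "a * ln (x - 1) \<le> f (x + a) - f x"
    using ln assms by (simp add: field_simps)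
  then have "exp (a * ln (x - 1)) \<le> exp (f (x + a) - f x)"
    by simp
  also have "\<dots> = Gamma (x + a) / Gamma x"
    using pos by (simp add: f_def exp_diff)
  finally show ?thesis
    using pos assms by (simp add: powr_def field_simps)
qed

text \<open>By the preceding bound the ratio of consecutive terms is at most \<open>\<bar>z\<bar> / (\<alpha> l) powr \<alpha>\<close>, which tends
  to \<open>0\<close>.\<close>

lemma summable_mittag_leffler:
  fixes \<alpha> z :: real
  assumes "\<alpha> > 0"
  shows "summable (\<lambda>l. z ^ l / Gamma (\<alpha> * real l + 1))"
proof -
  \<comment> \<open>Beyond this \<open>N\<close> the ratio of consecutive terms is at most \<open>1/2\<close>.\<close>
  obtain N where N0: "(2 * \<bar>z\<bar>) powr (1 / \<alpha>) / \<alpha> \<le> real N"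
    using real_arch_simple by blast
  have N: "2 * \<bar>z\<bar> \<le> (\<alpha> * real l) powr \<alpha>" if "l \<ge> N" for l
  proof -
    have "(2 * \<bar>z\<bar>) powr (1 / \<alpha>) / \<alpha> \<le> real l" using N0 that by linarith
    then have "(2 * \<bar>z\<bar>) powr (1 / \<alpha>) \<le> \<alpha> * real l" using assms by (simp add: field_simps)
    then have "((2 * \<bar>z\<bar>) powr (1 / \<alpha>)) powr \<alpha> \<le> (\<alpha> * real l) powr \<alpha>"
      using assms by (intro powr_mono2) auto
    then show ?thesis using assms by (simp add: powr_powr)
  qed
  show ?thesis
  proof (rule summable_ratio_test[of "1/2" "max N 1"])
    \<comment> \<open>\<open>l \<ge> 1\<close> is needed because the Gamma bound requires an argument above \<open>1\<close>.\<close>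
    fix l assume l: "l \<ge> max N 1"
    let ?G = "\<lambda>l. Gamma (\<alpha> * real l + 1)"
    have pos: "?G l > 0" "?G (Suc l) > 0"
      using assms by (auto intro!: Gamma_real_pos add_nonneg_pos)
    have "2 * \<bar>z\<bar> * ?G l \<le> (\<alpha> * real l) powr \<alpha> * ?G l"
      using N[of l] l pos by (intro mult_right_mono) auto
    also have "\<dots> \<le> ?G (Suc l)"
      using Gamma_add_ge[of "\<alpha> * real l + 1" \<alpha>] assms l by (simp add: algebra_simps)
    finally have *: "2 * \<bar>z\<bar> * ?G l \<le> ?G (Suc l)" .
    have "\<bar>z\<bar> ^ l * (2 * \<bar>z\<bar> * ?G l) \<le> \<bar>z\<bar> ^ l * ?G (Suc l)"
      by (rule mult_left_mono[OF *]) simp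
    then show "norm (z ^ Suc l / ?G (Suc l)) \<le> 1 / 2 * norm (z ^ l / ?G l)"
      using pos by (simp add: abs_mult power_abs field_simps del: of_nat_Suc)
  qed simp
qed

lemma summable_mittag_leffler_bounded:
  fixes \<alpha> z K r :: real and c :: "nat \<Rightarrow> real"
  assumes "\<alpha> > 0" and c: "\<And>l. \<bar>c l\<bar> \<le> K * r ^ l"
  shows "summable (\<lambda>l. c l / Gamma (\<alpha> * real l + 1) * z ^ l)"
proof (rule summable_comparison_test)
  show "\<exists>N. \<forall>l\<ge>N. norm (c l / Gamma (\<alpha> * real l + 1) * z ^ l) \<le> K * ((r * \<bar>z\<bar>) ^ l / Gamma (\<alpha> * real l + 1))"
  proof (intro exI allI impI)
    fix l
    have "Gamma (\<alpha> * real l + 1) > 0"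
      using assms by (auto intro!: Gamma_real_pos add_nonneg_pos)
    then show "norm (c l / Gamma (\<alpha> * real l + 1) * z ^ l) \<le> K * ((r * \<bar>z\<bar>) ^ l / Gamma (\<alpha> * real l + 1))"
      using mult_right_mono[OF c[of l], of "\<bar>z\<bar> ^ l"]
      by (simp add: abs_mult power_abs power_mult_distrib field_simps)
  qed
  show "summable (\<lambda>l. K * ((r * \<bar>z\<bar>) ^ l / Gamma (\<alpha> * real l + 1)))"
    using summable_mult[OF summable_mittag_leffler[OF \<open>\<alpha> > 0\<close>, of "r * \<bar>z\<bar>"], of K] by simp
qed

lemma has_integral_Beta_scaled:
  fixes a b t :: real
  assumes "a > 0" "b > 0" "t > 0"
  shows "((\<lambda>s. s powr (a - 1) * (t - s) powr (b - 1)) has_integral t powr (a + b - 1) * Beta a b) {0..t}"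
proof -
  have "(\<lambda>x. x * t) ` {0..1} = {0..t}"
    using assms by (simp add: image_mult_atLeastAtMost mult.commute[of _ t])
  then have "((\<lambda>s. (s / t) powr (a - 1) * (1 - s / t) powr (b - 1)) has_integral t * Beta a b) {0..t}"
    using has_integral_stretch_real[OF has_integral_Beta_real[OF assms(1,2)], of "1 / t"] assms
    by (simp add: divide_simps)
  from has_integral_mult_right[OF this, of "t powr (a + b - 2)"]
  have "((\<lambda>s. t powr (a + b - 2) * ((s / t) powr (a - 1) * (1 - s / t) powr (b - 1))) has_integral
      t powr (a + b - 2) * (t * Beta a b)) {0..t}" .
  moreover have "t powr (a + b - 2) * ((s / t) powr (a - 1) * (1 - s / t) powr (b - 1)) =
      s powr (a - 1) * (t - s) powr (b - 1)" if "s \<in> {0..t}" for s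
  proof -
    have "1 - s / t = (t - s) / t" using assms by (simp add: field_simps)
    moreover have "t powr (a + b - 2) = t powr (a - 1) * t powr (b - 1)"
      by (simp add: powr_add[symmetric])
    ultimately show ?thesis using that assms by (simp add: powr_divide)
  qed
  moreover have "t powr (a + b - 2) * t = t powr (a + b - 1)"
    using assms powr_add[of t "a + b - 2" 1] by (simp add: algebra_simps)
  ultimately show ?thesis
    by (metis (no_types, lifting) has_integral_eq mult.assoc)
qed

section \<open>Scalar Mittag-Leffler type series\<close>

text \<open>The Mittag-Leffler series in the variable \<open>t powr \<alpha>\<close> with coefficients \<open>c\<close>.  The components of
  \<open>E\<^sub>\<alpha>(A t\<^sup>\<alpha>) x\<close> and of its images under matrices all have this form, so that the analysis can be done
  for real power series.\<close>

definition ml_series :: "real \<Rightarrow> (nat \<Rightarrow> real) \<Rightarrow> real \<Rightarrow> real" where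
  "ml_series \<alpha> c t = (\<Sum>l. c l / Gamma (\<alpha> * real l + 1) * (t powr \<alpha>) ^ l)"

text \<open>The termwise derivative of \<^const>\<open>ml_series\<close>.  The power \<open>t powr (\<alpha> - 1)\<close>, singular at \<open>0\<close>, is split
  off, leaving an entire power series in \<open>t powr \<alpha>\<close>.\<close>

definition ml_series_deriv :: "real \<Rightarrow> (nat \<Rightarrow> real) \<Rightarrow> real \<Rightarrow> real" where
  "ml_series_deriv \<alpha> c t =
    (\<Sum>l. c (Suc l) / Gamma (\<alpha> * real l + \<alpha>) * (t powr \<alpha>) ^ l) * t powr (\<alpha> - 1)"

lemma diffs_mittag_leffler:
  fixes \<alpha> :: real
  assumes "\<alpha> > 0"
  shows "diffs (\<lambda>l. c l / Gamma (\<alpha> * real l + 1)) l = c (Suc l) / Gamma (\<alpha> * real l + \<alpha>) / \<alpha>"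
proof -
  have "\<alpha> * real l + \<alpha> > 0" using assms by (simp add: add_nonneg_pos)
  then have "Gamma (\<alpha> * real (Suc l) + 1) = (\<alpha> * real (Suc l)) * Gamma (\<alpha> * real l + \<alpha>)"
    using Gamma_plus1[of "\<alpha> * real l + \<alpha>"] nonpos_Ints_nonpos[of "\<alpha> * real l + \<alpha>"]
    by (force simp: algebra_simps)
  then show ?thesis using assms by (simp add: diffs_def del: of_nat_Suc)
qed

context
  fixes \<alpha> K r :: real and c :: "nat \<Rightarrow> real"
  assumes \<alpha>: "\<alpha> > 0" and c: "\<And>l. \<bar>c l\<bar> \<le> K * r ^ l"
begin

lemma summable_ml_deriv:
  "summable (\<lambda>l. c (Suc l) / Gamma (\<alpha> * real l + \<alpha>) * z ^ l)"
proof -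
  have "summable (\<lambda>l. diffs (\<lambda>l. c l / Gamma (\<alpha> * real l + 1)) l * z ^ l)"
    using summable_mittag_leffler_bounded[OF \<alpha> c] by (intro termdiff_converges_all)
  from summable_mult[OF this, of \<alpha>] show ?thesis
    using \<alpha> by (simp add: diffs_mittag_leffler)
qed

lemma ml_series_has_derivative:
  assumes t: "t > 0"
  shows "(ml_series \<alpha> c has_real_derivative ml_series_deriv \<alpha> c t) (at t)"
proof -
  have "((\<lambda>z. \<Sum>l. c l / Gamma (\<alpha> * real l + 1) * z ^ l) has_real_derivative
      (\<Sum>l. diffs (\<lambda>l. c l / Gamma (\<alpha> * real l + 1)) l * (t powr \<alpha>) ^ l)) (at (t powr \<alpha>))"
    by (intro termdiffs_strong_converges_everywhere summable_mittag_leffler_bounded[OF \<alpha> c])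
  moreover have "((\<lambda>t. t powr \<alpha>) has_real_derivative \<alpha> * t powr (\<alpha> - 1)) (at t)"
    using t by (intro has_real_derivative_powr)
  ultimately have "((\<lambda>t. \<Sum>l. c l / Gamma (\<alpha> * real l + 1) * (t powr \<alpha>) ^ l) has_real_derivative
      (\<Sum>l. diffs (\<lambda>l. c l / Gamma (\<alpha> * real l + 1)) l * (t powr \<alpha>) ^ l) * (\<alpha> * t powr (\<alpha> - 1))) (at t)"
    by (rule DERIV_chain2)
  moreover have "(\<Sum>l. diffs (\<lambda>l. c l / Gamma (\<alpha> * real l + 1)) l * (t powr \<alpha>) ^ l) * \<alpha> =
      (\<Sum>l. c (Suc l) / Gamma (\<alpha> * real l + \<alpha>) * (t powr \<alpha>) ^ l)"
    unfolding diffs_mittag_leffler[OF \<alpha>]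
    using suminf_divide[OF summable_ml_deriv[of "t powr \<alpha>"], of \<alpha>] \<alpha> by simp
  ultimately show ?thesis
    unfolding ml_series_def[abs_def] ml_series_deriv_def by (simp add: mult.assoc[symmetric])
qed

lemma continuous_on_ml_series: "continuous_on {0..} (ml_series \<alpha> c)"
proof -
  have F: "continuous_on UNIV (\<lambda>z. \<Sum>l. c l / Gamma (\<alpha> * real l + 1) * z ^ l)"
    by (intro continuous_at_imp_continuous_on ballI isCont_powser_converges_everywhere
        summable_mittag_leffler_bounded[OF \<alpha> c])
  have "continuous_on {0..} (\<lambda>t::real. t powr \<alpha>)"
    using \<alpha> by (intro continuous_on_powr') (auto intro: continuous_intros)
  then show ?thesis
    unfolding ml_series_def[abs_def] by (rule continuous_on_compose2[OF F]) simp
qed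

lemma continuous_on_ml_deriv_factor:
  "continuous_on {0..} (\<lambda>t. \<Sum>l. c (Suc l) / Gamma (\<alpha> * real l + \<alpha>) * (t powr \<alpha>) ^ l)"
proof -
  have F: "continuous_on UNIV (\<lambda>z. \<Sum>l. c (Suc l) / Gamma (\<alpha> * real l + \<alpha>) * z ^ l)"
    by (intro continuous_at_imp_continuous_on ballI isCont_powser_converges_everywhere
        summable_ml_deriv)
  have "continuous_on {0..} (\<lambda>t::real. t powr \<alpha>)"
    using \<alpha> by (intro continuous_on_powr') (auto intro: continuous_intros)
  then show ?thesis
    by (rule continuous_on_compose2[OF F]) simp
qed

lemma continuous_on_ml_series_deriv: "continuous_on {0<..} (ml_series_deriv \<alpha> c)"
  unfolding ml_series_deriv_def[abs_def]
  by (intro continuous_on_mult continuous_on_subset[OF continuous_on_ml_deriv_factor]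
      continuous_on_powr continuous_intros) auto

text \<open>A bounded factor times the integrable singularity \<open>t powr (\<alpha> - 1)\<close>.\<close>

lemma absolutely_integrable_ml_series_deriv:
  assumes "T \<ge> 0"
  shows "ml_series_deriv \<alpha> c absolutely_integrable_on {0..T}"
  unfolding ml_series_deriv_def[abs_def]
proof (rule absolutely_integrable_bounded_measurable_product_real)
  have cont: "continuous_on {0..T} (\<lambda>t. \<Sum>l. c (Suc l) / Gamma (\<alpha> * real l + \<alpha>) * (t powr \<alpha>) ^ l)"
    by (rule continuous_on_subset[OF continuous_on_ml_deriv_factor]) auto
  then show "(\<lambda>t. \<Sum>l. c (Suc l) / Gamma (\<alpha> * real l + \<alpha>) * (t powr \<alpha>) ^ l)
      \<in> borel_measurable (lebesgue_on {0..T})"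
    by (rule continuous_imp_measurable_on_sets_lebesgue) simp
  show "bounded ((\<lambda>t. \<Sum>l. c (Suc l) / Gamma (\<alpha> * real l + \<alpha>) * (t powr \<alpha>) ^ l) ` {0..T})"
    by (intro compact_imp_bounded compact_continuous_image cont) simp
  show "(\<lambda>t. t powr (\<alpha> - 1)) absolutely_integrable_on {0..T}"
    using \<alpha> assms
    by (subst absolutely_integrable_on_iff_nonneg) (auto intro!: integrable_on_powr_from_0)
qed simp

end

text \<open>The scalar Caputo derivative (up to the factor \<open>\<Gamma>(1 - \<alpha>)\<close>) shifts the coefficients of a
  Mittag-Leffler series: the integral of each term is a Beta integral, in which \<open>\<Gamma>(\<alpha> l + \<alpha>)\<close>
  cancels.  The series is integrated termwise by dominated convergence, with a constant
  multiple of \<open>s powr (\<alpha> - 1) * (t - s) powr (- \<alpha>)\<close> as majorant.\<close>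

lemma abel_integral_ml_series_deriv:
  fixes \<alpha> K r t :: real and c :: "nat \<Rightarrow> real"
  assumes \<alpha>: "0 < \<alpha>" "\<alpha> < 1" and c: "\<And>l. \<bar>c l\<bar> \<le> K * r ^ l" and t: "t > 0"
  shows "((\<lambda>s. (t - s) powr (- \<alpha>) * ml_series_deriv \<alpha> c s) has_integral
    Gamma (1 - \<alpha>) * ml_series \<alpha> (\<lambda>l. c (Suc l)) t) {0..t}"
proof -
  define d where "d l = c (Suc l) / Gamma (\<alpha> * real l + \<alpha>)" for l
  have pos: "\<alpha> * real l + \<alpha> > 0" "Gamma (\<alpha> * real l + \<alpha>) > 0" "Gamma (\<alpha> * real l + 1) > 0" for l
    using \<alpha> by (auto intro!: Gamma_real_pos add_nonneg_pos)
  define g where "g l s = d l * (s powr \<alpha>) ^ l * (s powr (\<alpha> - 1) * (t - s) powr (- \<alpha>))" for l s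
  have g: "(g l has_integral Gamma (1 - \<alpha>) * (c (Suc l) / Gamma (\<alpha> * real l + 1) * (t powr \<alpha>) ^ l)) {0..t}"
    for l
  proof -
    have "((\<lambda>s. d l * (s powr (\<alpha> * real l + \<alpha> - 1) * (t - s) powr (1 - \<alpha> - 1))) has_integral
        d l * (t powr (\<alpha> * real l + \<alpha> + (1 - \<alpha>) - 1) * Beta (\<alpha> * real l + \<alpha>) (1 - \<alpha>))) {0..t}"
      using \<alpha> t pos(1)[of l] by (intro has_integral_mult_right has_integral_Beta_scaled) auto
    \<comment> \<open>At \<open>s = 0\<close> both sides vanish because \<open>0 powr a = 0\<close>.\<close>
    moreover have "d l * (s powr (\<alpha> * real l + \<alpha> - 1) * (t - s) powr (1 - \<alpha> - 1)) = g l s"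
      if "s \<in> {0..t}" for s
    proof (cases "s = 0")
      case False
      then have "s powr (\<alpha> * real l + \<alpha> - 1) = (s powr \<alpha>) ^ l * s powr (\<alpha> - 1)"
        using that powr_add[of s "\<alpha> * real l" "\<alpha> - 1"]
        by (simp add: powr_realpow[symmetric] powr_powr add_diff_eq)
      then show ?thesis by (simp add: g_def)
    qed (simp add: g_def)
    moreover have "d l * (t powr (\<alpha> * real l + \<alpha> + (1 - \<alpha>) - 1) * Beta (\<alpha> * real l + \<alpha>) (1 - \<alpha>))
        = Gamma (1 - \<alpha>) * (c (Suc l) / Gamma (\<alpha> * real l + 1) * (t powr \<alpha>) ^ l)"
      using t pos(1)[of l] pos(2,3)[of l, THEN less_imp_neq] by (simp add: d_def Beta_def powr_realpow[symmetric] powr_powr)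
    ultimately show ?thesis
      by (metis (no_types, lifting) has_integral_eq)
  qed
  have summ_c: "summable (\<lambda>l. d l * z ^ l)" for z
    unfolding d_def by (rule summable_ml_deriv[OF \<alpha>(1) c])
  have "summable (\<lambda>l. \<bar>c (Suc l)\<bar> / Gamma (\<alpha> * real l + \<alpha>) * (t powr \<alpha>) ^ l)"
    by (rule summable_ml_deriv[where c = "\<lambda>l. \<bar>c l\<bar>", OF \<alpha>(1), of K r]) (simp add: c)
  then have summ_abs: "summable (\<lambda>l. \<bar>d l\<bar> * (t powr \<alpha>) ^ l)"
    using pos(2) by (simp add: d_def abs_of_pos)
  define M where "M = (\<Sum>l. \<bar>d l\<bar> * (t powr \<alpha>) ^ l)"
  have bound: "norm (\<Sum>l<n. g l s) \<le> M * (s powr (\<alpha> - 1) * (t - s) powr (- \<alpha>))"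
    if s: "s \<in> {0..t}" for n s
  proof -
    have "\<bar>\<Sum>l<n. d l * (s powr \<alpha>) ^ l\<bar> \<le> (\<Sum>l<n. \<bar>d l\<bar> * (t powr \<alpha>) ^ l)"
      using s \<alpha> by (intro order.trans[OF sum_abs] sum_mono)
        (auto simp: abs_mult intro!: mult_left_mono power_mono powr_mono2)
    also have "\<dots> \<le> M"
      unfolding M_def by (rule sum_le_suminf[OF summ_abs]) auto
    finally show ?thesis
      unfolding g_def sum_distrib_right[symmetric]
      by (simp add: abs_mult mult_right_mono)
  qed
  have lim: "(\<lambda>n. \<Sum>l<n. g l s) \<longlonglongrightarrow> (t - s) powr (- \<alpha>) * ml_series_deriv \<alpha> c s" for s
  proof -
    have "(\<lambda>l. d l * (s powr \<alpha>) ^ l) sums (\<Sum>l. d l * (s powr \<alpha>) ^ l)"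
      by (rule summable_sums[OF summ_c])
    then have "(\<lambda>l. d l * (s powr \<alpha>) ^ l * (s powr (\<alpha> - 1) * (t - s) powr (- \<alpha>))) sums
        ((\<Sum>l. d l * (s powr \<alpha>) ^ l) * (s powr (\<alpha> - 1) * (t - s) powr (- \<alpha>)))"
      by (rule sums_mult2)
    then show ?thesis
      unfolding sums_def g_def ml_series_deriv_def d_def by (simp add: mult_ac)
  qed
  have sum: "((\<lambda>s. \<Sum>l<n. g l s) has_integral
      (\<Sum>l<n. Gamma (1 - \<alpha>) * (c (Suc l) / Gamma (\<alpha> * real l + 1) * (t powr \<alpha>) ^ l))) {0..t}" for n
    by (intro has_integral_sum g) simp
  have h: "(\<lambda>s. M * (s powr (\<alpha> - 1) * (t - s) powr (- \<alpha>))) integrable_on {0..t}"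
    using has_integral_mult_right[OF has_integral_Beta_scaled[of \<alpha> "1 - \<alpha>" t], of M] \<alpha> t
    by (auto simp: integrable_on_def)
  have int: "(\<lambda>s. (t - s) powr (- \<alpha>) * ml_series_deriv \<alpha> c s) integrable_on {0..t}"
    and conv: "(\<lambda>n. integral {0..t} (\<lambda>s. \<Sum>l<n. g l s)) \<longlonglongrightarrow>
      integral {0..t} (\<lambda>s. (t - s) powr (- \<alpha>) * ml_series_deriv \<alpha> c s)"
    using dominated_convergence[OF has_integral_integrable[OF sum] h bound lim] by auto
  have "\<bar>c (Suc l)\<bar> \<le> (K * r) * r ^ l" for l using c[of "Suc l"] by (simp add: mult_ac)
  then have "summable (\<lambda>l. c (Suc l) / Gamma (\<alpha> * real l + 1) * (t powr \<alpha>) ^ l)"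
    by (rule summable_mittag_leffler_bounded[OF \<alpha>(1)])
  then have "(\<lambda>l. Gamma (1 - \<alpha>) * (c (Suc l) / Gamma (\<alpha> * real l + 1) * (t powr \<alpha>) ^ l)) sums
      (Gamma (1 - \<alpha>) * ml_series \<alpha> (\<lambda>l. c (Suc l)) t)"
    unfolding ml_series_def by (intro sums_mult summable_sums)
  then have "(\<lambda>n. integral {0..t} (\<lambda>s. \<Sum>l<n. g l s)) \<longlonglongrightarrow>
      Gamma (1 - \<alpha>) * ml_series \<alpha> (\<lambda>l. c (Suc l)) t"
    unfolding integral_unique[OF sum] sums_def .
  with conv have "integral {0..t} (\<lambda>s. (t - s) powr (- \<alpha>) * ml_series_deriv \<alpha> c s) =
      Gamma (1 - \<alpha>) * ml_series \<alpha> (\<lambda>l. c (Suc l)) t"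
    by (rule LIMSEQ_unique)
  then show ?thesis
    using int by (metis integrable_integral)
qed

section \<open>Matrix Mittag-Leffler functions and the free response\<close>

lemma has_integral_vec_iff:
  fixes f :: "'a::euclidean_space \<Rightarrow> real ^ 'n"
  shows "(f has_integral y) S \<longleftrightarrow> (\<forall>i. ((\<lambda>x. f x $ i) has_integral y $ i) S)"
  by (subst has_integral_componentwise_iff) (auto simp: Basis_vec_def inner_axis)

lemma absolutely_integrable_vec_iff:
  fixes f :: "'a::euclidean_space \<Rightarrow> real ^ 'n"
  shows "f absolutely_integrable_on S \<longleftrightarrow> (\<forall>i. (\<lambda>x. f x $ i) absolutely_integrable_on S)"
  by (subst absolutely_integrable_componentwise_iff) (auto simp: Basis_vec_def inner_axis)

lemma has_vector_derivative_vec_iff: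
  fixes f :: "real \<Rightarrow> real ^ 'n"
  shows "(f has_vector_derivative d) (at t within S) \<longleftrightarrow>
    (\<forall>i. ((\<lambda>x. f x $ i) has_real_derivative d $ i) (at t within S))"
  unfolding has_vector_derivative_def has_field_derivative_def
  by (subst has_derivative_componentwise_within)
    (auto simp: Basis_vec_def inner_axis mult_commute_abs)

lemma sums_vec_iff:
  fixes f :: "nat \<Rightarrow> 'a::real_normed_vector ^ 'n"
  shows "f sums s \<longleftrightarrow> (\<forall>i. (\<lambda>l. f l $ i) sums (s $ i))"
proof
  assume "f sums s"
  then show "\<forall>i. (\<lambda>l. f l $ i) sums (s $ i)"
    unfolding sums_def by (auto dest: tendsto_vec_nth)
next
  assume "\<forall>i. (\<lambda>l. f l $ i) sums (s $ i)"
  then show "f sums s"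
    unfolding sums_def by (intro vec_tendstoI) simp
qed

lemma matpow_norm_bound:
  fixes A :: "real ^ 'n ^ 'n"
  obtains r where "r > 0" "\<And>l x. norm (matpow A l *v x) \<le> norm x * r ^ l"
proof -
  obtain r where r: "r > 0" "\<And>x. norm (A *v x) \<le> norm x * r"
    using bounded_linear.pos_bounded[OF matrix_vector_mul_bounded_linear[of A]] by blast
  have "norm (matpow A l *v x) \<le> norm x * r ^ l" for l x
  proof (induction l)
    case (Suc l)
    have "norm (matpow A (Suc l) *v x) \<le> norm (matpow A l *v x) * r"
      using r(2) by (simp flip: matrix_vector_mul_assoc)
    also have "\<dots> \<le> norm x * r ^ l * r"
      using Suc r(1) by (intro mult_right_mono) auto
    finally show ?case by (simp add: mult_ac)
  qed simp
  with r(1) show ?thesis by (rule that)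
qed

text \<open>The coefficients seen through any matrix \<open>P\<close> grow at most geometrically, which is the
  hypothesis under which the scalar series were studied.\<close>

lemma output_coeff_bound:
  fixes A :: "real ^ 'n ^ 'n" and P :: "real ^ 'n ^ 'p"
  obtains K r where "\<And>l i. \<bar>(P *v (matpow A l *v x)) $ i\<bar> \<le> K * r ^ l"
proof -
  obtain r where r: "r > 0" "\<And>l x. norm (matpow A l *v x) \<le> norm x * r ^ l"
    using matpow_norm_bound[of A] by blast
  obtain q where q: "q > 0" "\<And>x. norm (P *v x) \<le> norm x * q"
    using bounded_linear.pos_bounded[OF matrix_vector_mul_bounded_linear[of P]] by blast
  have "\<bar>(P *v (matpow A l *v x)) $ i\<bar> \<le> norm x * q * r ^ l" for l i
  proof -
    have "\<bar>(P *v (matpow A l *v x)) $ i\<bar> \<le> norm (matpow A l *v x) * q"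
      using component_le_norm_cart q(2) by (rule order.trans)
    also have "\<dots> \<le> norm x * r ^ l * q"
      using r(2) q(1) by (intro mult_right_mono) auto
    finally show ?thesis by (simp add: mult_ac)
  qed
  then show ?thesis by (rule that)
qed

lemma summable_mittag_leffler_matrix:
  fixes A :: "real ^ 'n ^ 'n"
  assumes "\<alpha> > 0"
  shows "summable (\<lambda>l. (1 / Gamma (\<alpha> * real l + 1)) *\<^sub>R matpow (z *\<^sub>R A) l)"
proof -
  have "summable (\<lambda>l. ((1 / Gamma (\<alpha> * real l + 1)) *\<^sub>R matpow (z *\<^sub>R A) l) $ i $ j)" for i j
  proof -
    obtain K r where "\<And>l i. \<bar>(mat 1 *v (matpow A l *v axis j 1)) $ i\<bar> \<le> K * r ^ l"
      using output_coeff_bound[of "mat 1 :: real ^ 'n ^ 'n" A "axis j 1"] by blast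
    then have "\<bar>matpow A l $ i $ j\<bar> \<le> K * r ^ l" for l
      by (simp add: matrix_vector_mult_basis column_def)
    from summable_mittag_leffler_bounded[OF assms this, of z] show ?thesis
      by (simp add: matpow_scaleR mult_ac)
  qed
  then have "(\<lambda>l. (1 / Gamma (\<alpha> * real l + 1)) *\<^sub>R matpow (z *\<^sub>R A) l) sums
      (\<chi> i j. \<Sum>l. ((1 / Gamma (\<alpha> * real l + 1)) *\<^sub>R matpow (z *\<^sub>R A) l) $ i $ j)"
    by (simp add: sums_vec_iff summable_sums)
  then show ?thesis by (rule sums_summable)
qed

text \<open>The matrix \<open>P\<close> covers three uses at once: the identity gives the components of
  \<open>E\<^sub>\<alpha>(A t\<^sup>\<alpha>) x\<close>, \<open>P = A\<close> the right-hand side of the differential equation, and \<open>P = C\<close> the output.\<close>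

lemma mittag_leffler_output:
  fixes A :: "real ^ 'n ^ 'n" and P :: "real ^ 'n ^ 'p"
  assumes "\<alpha> > 0"
  shows "(P *v (mittag_leffler \<alpha> (t powr \<alpha> *\<^sub>R A) *v x)) $ i =
    ml_series \<alpha> (\<lambda>l. (P *v (matpow A l *v x)) $ i) t"
proof -
  have "linear (\<lambda>M :: real ^ 'n ^ 'n. (P *v (M *v x)) $ i)"
    by (rule linearI) (simp_all add: matrix_vector_mult_add_rdistrib matrix_vector_right_distrib
        scaleR_matrix_vector_assoc[symmetric] matrix_vector_mult_scaleR)
  then have "bounded_linear (\<lambda>M :: real ^ 'n ^ 'n. (P *v (M *v x)) $ i)"
    by (simp add: linear_conv_bounded_linear)
  from bounded_linear.suminf[OF this summable_mittag_leffler_matrix[OF assms, of "t powr \<alpha>" A]]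
  show ?thesis
    unfolding mittag_leffler_def mittag_leffler2_def ml_series_def
    by (simp add: matpow_scaleR scaleR_matrix_vector_assoc[symmetric] matrix_vector_mult_scaleR mult_ac)
qed

definition free_response :: "real \<Rightarrow> real \<Rightarrow> real ^ 'n ^ 'n \<Rightarrow> real ^ 'n \<Rightarrow> real \<Rightarrow> real ^ 'n" where
  "free_response \<alpha> \<rho> A x t = exp (- \<rho> * t) *\<^sub>R (mittag_leffler \<alpha> (t powr \<alpha> *\<^sub>R A) *v x)"

text \<open>The free response is the trajectory for zero input.  Its initial value, its derivative and its
  output are computed from this formula with suitable \<open>P\<close>.\<close>

lemma free_response_output:
  assumes "\<alpha> > 0"
  shows "(P *v free_response \<alpha> \<rho> A x t) $ i =
    exp (- \<rho> * t) * ml_series \<alpha> (\<lambda>l. (P *v (matpow A l *v x)) $ i) t"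
  using mittag_leffler_output[OF assms, of P t A x i]
  by (simp add: free_response_def matrix_vector_mult_scaleR)

section \<open>The tempered Caputo derivative along solutions\<close>

definition tempered_kernel :: "real \<Rightarrow> real \<Rightarrow> real \<Rightarrow> real \<Rightarrow> real" where
  "tempered_kernel \<alpha> \<rho> t s = exp (- \<rho> * (t - s)) * (t - s) powr (- \<alpha>)"

lemma absolutely_integrable_scaleR_continuous_left:
  fixes k :: "real \<Rightarrow> real" and g :: "real \<Rightarrow> 'a::euclidean_space"
  assumes "continuous_on {a..b} k" "g absolutely_integrable_on {a..b}"
  shows "(\<lambda>s. k s *\<^sub>R g s) absolutely_integrable_on {a..b}"
proof (rule absolutely_integrable_bounded_measurable_product[of "(*\<^sub>R)"])
  show "k \<in> borel_measurable (lebesgue_on {a..b})"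
    using assms(1) by (rule continuous_imp_measurable_on_sets_lebesgue) simp
  show "bounded (k ` {a..b})"
    by (intro compact_imp_bounded compact_continuous_image assms) simp
  show "bilinear ((*\<^sub>R) :: real \<Rightarrow> 'a \<Rightarrow> 'a)"
    by (simp add: bilinear_conv_bounded_bilinear bounded_bilinear_scaleR)
qed (use assms in auto)

lemma absolutely_integrable_scaleR_continuous_right:
  fixes k :: "real \<Rightarrow> real" and g :: "real \<Rightarrow> 'a::euclidean_space"
  assumes "k absolutely_integrable_on {a..b}" "continuous_on {a..b} g"
  shows "(\<lambda>s. k s *\<^sub>R g s) absolutely_integrable_on {a..b}"
proof (rule absolutely_integrable_bounded_measurable_product[of "\<lambda>x y. y *\<^sub>R x"])
  show "g \<in> borel_measurable (lebesgue_on {a..b})"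
    using assms(2) by (rule continuous_imp_measurable_on_sets_lebesgue) simp
  show "bounded (g ` {a..b})"
    by (intro compact_imp_bounded compact_continuous_image assms) simp
  show "bilinear (\<lambda>x y. y *\<^sub>R x :: 'a)"
    by (simp add: bilinear_conv_bounded_bilinear bounded_bilinear.flip[OF bounded_bilinear_scaleR])
qed (use assms in auto)

lemma tempered_kernel_absolutely_integrable:
  assumes "\<alpha> < 1" "t \<ge> 0"
  shows "tempered_kernel \<alpha> \<rho> t absolutely_integrable_on {0..t}"
proof -
  have "(\<lambda>s. s powr (- \<alpha>)) integrable_on cbox 0 t"
    using assms by (simp add: integrable_on_powr_from_0)
  from integrable_affinity[OF this, of "-1" t]
  have "(\<lambda>s. (t - s) powr (- \<alpha>)) integrable_on {0..t}"
    using assms by simp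
  then have "(\<lambda>s. (t - s) powr (- \<alpha>)) absolutely_integrable_on {0..t}"
    by (subst absolutely_integrable_on_iff_nonneg) auto
  then show ?thesis
    unfolding tempered_kernel_def[abs_def]
    by (intro absolutely_integrable_bounded_measurable_product_real compact_imp_bounded
        compact_continuous_image continuous_imp_measurable_on_sets_lebesgue continuous_intros) auto
qed

text \<open>The kernel is singular only at \<open>s = t\<close> and \<open>g\<close> only at \<open>s = 0\<close>.  On either half of \<open>[0, t]\<close> one factor
  is continuous and the other integrable.\<close>

lemma tempered_kernel_convolution_integrable:
  fixes g :: "real \<Rightarrow> 'a::euclidean_space"
  assumes "\<alpha> < 1" "t > 0" and g: "g absolutely_integrable_on {0..t}" "continuous_on {0<..t} g"
  shows "(\<lambda>s. tempered_kernel \<alpha> \<rho> t s *\<^sub>R g s) integrable_on {0..t}"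
proof (rule Henstock_Kurzweil_Integration.integrable_combine[where a = 0 and c = "t/2" and b = t])
  show "(\<lambda>s. tempered_kernel \<alpha> \<rho> t s *\<^sub>R g s) integrable_on {0..t/2}"
  proof (intro set_lebesgue_integral_eq_integral(1) absolutely_integrable_scaleR_continuous_left)
    show "continuous_on {0..t/2} (tempered_kernel \<alpha> \<rho> t)"
      unfolding tempered_kernel_def using assms by (auto intro!: continuous_intros)
    show "g absolutely_integrable_on {0..t/2}"
      by (rule absolutely_integrable_on_subinterval[OF g(1)]) (use assms in auto)
  qed
  show "(\<lambda>s. tempered_kernel \<alpha> \<rho> t s *\<^sub>R g s) integrable_on {t/2..t}"
  proof (intro set_lebesgue_integral_eq_integral(1) absolutely_integrable_scaleR_continuous_right)
    show "continuous_on {t/2..t} g"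
      by (rule continuous_on_subset[OF g(2)]) (use assms in auto)
    show "tempered_kernel \<alpha> \<rho> t absolutely_integrable_on {t/2..t}"
      by (rule absolutely_integrable_on_subinterval[OF tempered_kernel_absolutely_integrable[of \<alpha> t]])
        (use assms in auto)
  qed
qed (use assms in auto)

text \<open>The Caputo derivative is defined by an integral that is \<open>0\<close> by convention when it does not exist.
  Here it exists, so that a prescribed value can be stated as \<open>has_integral\<close>, a form that is
  preserved by linear maps and differences.\<close>

lemma tempered_caputo_eq_iff:
  fixes y y' :: "real \<Rightarrow> real ^ 'n"
  assumes \<alpha>: "\<alpha> < 1" and t: "0 < t" "t \<le> T"
    and y: "continuous_on {0..T} y"
    and deriv: "\<And>t. t \<in> {0<..T} \<Longrightarrow> (y has_vector_derivative y' t) (at t within {0..T})"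
    and y': "continuous_on {0<..T} y'" "y' absolutely_integrable_on {0..T}"
  shows "tempered_caputo \<alpha> \<rho> y t = z \<longleftrightarrow>
    ((\<lambda>s. tempered_kernel \<alpha> \<rho> t s *\<^sub>R (\<rho> *\<^sub>R y s + y' s)) has_integral Gamma (1 - \<alpha>) *\<^sub>R z) {0..t}"
proof -
  let ?h = "\<lambda>s. tempered_kernel \<alpha> \<rho> t s *\<^sub>R (\<rho> *\<^sub>R y s + y' s)"
  have "y absolutely_integrable_on {0..t}"
    using y t by (intro absolutely_integrable_continuous_real) (auto elim: continuous_on_subset)
  moreover have "y' absolutely_integrable_on {0..t}"
    using y'(2) by (rule absolutely_integrable_on_subinterval) (use t in auto)
  ultimately have "(\<lambda>s. \<rho> *\<^sub>R y s + y' s) absolutely_integrable_on {0..t}"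
    by (rule set_integral_add(1)[OF absolutely_integrable_scaleR_left])
  moreover have "continuous_on {0<..t} (\<lambda>s. \<rho> *\<^sub>R y s + y' s)"
    using t by (intro continuous_intros continuous_on_subset[OF y] continuous_on_subset[OF y'(1)]) auto
  ultimately have int: "?h integrable_on {0..t}"
    by (rule tempered_kernel_convolution_integrable[OF \<alpha> t(1)])
  \<comment> \<open>The two-sided derivative used in the definition agrees with \<open>y'\<close> inside the interval; the endpoints form a null set.\<close>
  have vd: "vector_derivative y (at s) = y' s" if "s \<in> {0..t} - {0, t}" for s
  proof -
    have "at s within {0..T} = at s"
      using that t by (intro at_within_interior) auto
    then show ?thesis
      using deriv[of s] that t by (auto intro: vector_derivative_at)
  qed
  have "tempered_caputo \<alpha> \<rho> y t = (1 / Gamma (1 - \<alpha>)) *\<^sub>R integral {0..t} ?h"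
    unfolding tempered_caputo_def
    by (intro arg_cong[where f = "(*\<^sub>R) _"] integral_spike[of "{0, t}"])
      (simp_all add: vd tempered_kernel_def)
  moreover have "Gamma (1 - \<alpha>) > 0" using \<alpha> by (intro Gamma_real_pos) simp
  ultimately have "tempered_caputo \<alpha> \<rho> y t = z \<longleftrightarrow> integral {0..t} ?h = Gamma (1 - \<alpha>) *\<^sub>R z"
    using scaleR_cancel_left[of "Gamma (1 - \<alpha>)" "tempered_caputo \<alpha> \<rho> y t" z] by simp
  then show ?thesis
    using int by (simp add: has_integral_iff)
qed

lemma equation_solution_iff:
  assumes \<alpha>: "\<alpha> < 1"
  shows "equation_solution \<alpha> \<rho> T A B u y0 y \<longleftrightarrow>
    continuous_on {0..T} y \<and> y 0 = y0 \<and>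
    (\<exists>y'. (\<forall>t\<in>{0<..T}. (y has_vector_derivative y' t) (at t within {0..T})) \<and>
      continuous_on {0<..T} y' \<and> y' absolutely_integrable_on {0..T} \<and>
      (\<forall>t\<in>{0<..T}. ((\<lambda>s. tempered_kernel \<alpha> \<rho> t s *\<^sub>R (\<rho> *\<^sub>R y s + y' s)) has_integral
        Gamma (1 - \<alpha>) *\<^sub>R (A *v y t + B *v u t)) {0..t}))"
proof -
  have *: "tempered_caputo \<alpha> \<rho> y t = A *v y t + B *v u t \<longleftrightarrow>
      ((\<lambda>s. tempered_kernel \<alpha> \<rho> t s *\<^sub>R (\<rho> *\<^sub>R y s + y' s)) has_integral
        Gamma (1 - \<alpha>) *\<^sub>R (A *v y t + B *v u t)) {0..t}"
    if "continuous_on {0..T} y" "\<forall>t\<in>{0<..T}. (y has_vector_derivative y' t) (at t within {0..T})"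
      "continuous_on {0<..T} y'" "y' absolutely_integrable_on {0..T}" "t \<in> {0<..T}" for y' t
    by (rule tempered_caputo_eq_iff[of \<alpha> t T y y']) (use that \<alpha> in auto)
  show ?thesis
    unfolding equation_solution_def
  proof (intro iffI conjI; elim conjE exE)
    fix y'
    assume "continuous_on {0..T} y" "\<forall>t\<in>{0<..T}. (y has_vector_derivative y' t) (at t within {0..T})"
      "continuous_on {0<..T} y'" "y' absolutely_integrable_on {0..T}"
      "\<forall>t\<in>{0<..T}. tempered_caputo \<alpha> \<rho> y t = A *v y t + B *v u t"
    then show "\<exists>y'. (\<forall>t\<in>{0<..T}. (y has_vector_derivative y' t) (at t within {0..T})) \<and>
      continuous_on {0<..T} y' \<and> y' absolutely_integrable_on {0..T} \<and>
      (\<forall>t\<in>{0<..T}. ((\<lambda>s. tempered_kernel \<alpha> \<rho> t s *\<^sub>R (\<rho> *\<^sub>R y s + y' s)) has_integral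
        Gamma (1 - \<alpha>) *\<^sub>R (A *v y t + B *v u t)) {0..t})"
      using *[of y'] by (intro exI[of _ y']) simp
  next
    fix y'
    assume "continuous_on {0..T} y" "\<forall>t\<in>{0<..T}. (y has_vector_derivative y' t) (at t within {0..T})"
      "continuous_on {0<..T} y'" "y' absolutely_integrable_on {0..T}"
      "\<forall>t\<in>{0<..T}. ((\<lambda>s. tempered_kernel \<alpha> \<rho> t s *\<^sub>R (\<rho> *\<^sub>R y s + y' s)) has_integral
        Gamma (1 - \<alpha>) *\<^sub>R (A *v y t + B *v u t)) {0..t}"
    then show "\<forall>t\<in>{0<..T}. tempered_caputo \<alpha> \<rho> y t = A *v y t + B *v u t"
      using *[of y'] by simp
  qed blast+
qed

lemma free_response_0:
  assumes "\<alpha> > 0"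
  shows "free_response \<alpha> \<rho> A x 0 = x"
proof -
  have "ml_series \<alpha> c 0 = c 0" for c
    using powser_zero[of "\<lambda>l. c l / Gamma (\<alpha> * real l + 1)"] assms by (simp add: ml_series_def)
  then show ?thesis
    using free_response_output[OF assms, of "mat 1" \<rho> A x 0] by (simp add: vec_eq_iff)
qed

text \<open>In \<open>\<rho> w + w'\<close> the terms from differentiating the factor \<open>exp (- \<rho> s)\<close> cancel, and the exponential
  of the kernel combines with this factor to \<open>exp (- \<rho> t)\<close>.  What remains is the untempered Caputo
  derivative of the Mittag-Leffler series, a shift of the coefficients \<open>A\<^sup>l x\<close>, hence
  multiplication by \<open>A\<close>.\<close>

lemma free_response_equation_solution:
  fixes A :: "real ^ 'n ^ 'n" and B :: "real ^ 'm ^ 'n"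
  assumes \<alpha>: "0 < \<alpha>" "\<alpha> < 1" and T: "T > 0"
  shows "equation_solution \<alpha> \<rho> T A B (\<lambda>_. 0) x (free_response \<alpha> \<rho> A x)"
proof -
  let ?w = "free_response \<alpha> \<rho> A x"
  define c where "c i l = (matpow A l *v x) $ i" for i l
  obtain K r where "\<And>l i. \<bar>(mat 1 *v (matpow A l *v x)) $ i\<bar> \<le> K * r ^ l"
    using output_coeff_bound[of "mat 1 :: real ^ 'n ^ 'n" A x] by blast
  then have c: "\<bar>c i l\<bar> \<le> K * r ^ l" for i l by (simp add: c_def)
  have w: "?w t $ i = exp (- \<rho> * t) * ml_series \<alpha> (c i) t" for t i
    using free_response_output[OF \<alpha>(1), of "mat 1" \<rho> A x t i] by (simp add: c_def[abs_def])
  have Aw: "(A *v ?w t) $ i = exp (- \<rho> * t) * ml_series \<alpha> (\<lambda>l. c i (Suc l)) t" for t i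
    using free_response_output[OF \<alpha>(1), of A \<rho> A x t i]
    by (simp add: c_def[abs_def] matrix_vector_mul_assoc)
  \<comment> \<open>\<open>d\<close> is \<open>\<rho> w + w'\<close>.\<close>
  define d where "d t = exp (- \<rho> * t) *\<^sub>R (\<chi> i. ml_series_deriv \<alpha> (c i) t)" for t
  define w' where "w' t = d t - \<rho> *\<^sub>R ?w t" for t
  have cont_w: "continuous_on {0..T} ?w"
  proof -
    have "continuous_on {0..T} (\<lambda>t. \<chi> i. ?w t $ i)"
      unfolding w
      by (intro continuous_on_vec_lambda continuous_intros
          continuous_on_subset[OF continuous_on_ml_series[OF \<alpha>(1) c]]) auto
    then show ?thesis by simp
  qed
  have deriv: "(?w has_vector_derivative w' t) (at t within {0..T})" if "t \<in> {0<..T}" for t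
    unfolding has_vector_derivative_vec_iff
  proof
    fix i
    have "((\<lambda>t. exp (- \<rho> * t) * ml_series \<alpha> (c i) t) has_real_derivative w' t $ i) (at t within {0..T})"
      using that
      by (auto intro!: derivative_eq_intros ml_series_has_derivative[OF \<alpha>(1) c, THEN has_field_derivative_at_within]
          simp: w'_def d_def w algebra_simps)
    then show "((\<lambda>t. ?w t $ i) has_real_derivative w' t $ i) (at t within {0..T})"
      by (simp add: w)
  qed
  have "continuous_on {0<..T} d"
    unfolding d_def[abs_def]
    by (intro continuous_on_vec_lambda continuous_intros
          continuous_on_subset[OF continuous_on_ml_series_deriv[OF \<alpha>(1) c]]) auto
  then have cont_w': "continuous_on {0<..T} w'"
    unfolding w'_def[abs_def]
    by (intro continuous_intros continuous_on_subset[OF cont_w]) auto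
  have "d absolutely_integrable_on {0..T}"
    unfolding d_def[abs_def]
  proof (rule absolutely_integrable_scaleR_continuous_left)
    show "(\<lambda>t. \<chi> i. ml_series_deriv \<alpha> (c i) t) absolutely_integrable_on {0..T}"
      unfolding absolutely_integrable_vec_iff
      using absolutely_integrable_ml_series_deriv[OF \<alpha>(1) c, of T] T by simp
  qed (intro continuous_intros)
  moreover have "(\<lambda>t. \<rho> *\<^sub>R ?w t) absolutely_integrable_on {0..T}"
    by (intro absolutely_integrable_continuous_real continuous_intros cont_w)
  ultimately have int_w': "w' absolutely_integrable_on {0..T}"
    unfolding w'_def[abs_def] by (rule set_integral_diff(1))
  have caputo: "((\<lambda>s. tempered_kernel \<alpha> \<rho> t s *\<^sub>R (\<rho> *\<^sub>R ?w s + w' s)) has_integral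
      Gamma (1 - \<alpha>) *\<^sub>R (A *v ?w t)) {0..t}" if t: "t > 0" for t
    unfolding has_integral_vec_iff
  proof
    fix i
    have "((\<lambda>s. exp (- \<rho> * t) * ((t - s) powr (- \<alpha>) * ml_series_deriv \<alpha> (c i) s)) has_integral
        exp (- \<rho> * t) * (Gamma (1 - \<alpha>) * ml_series \<alpha> (\<lambda>l. c i (Suc l)) t)) {0..t}"
      by (intro has_integral_mult_right abel_integral_ml_series_deriv[OF \<alpha> c t])
    moreover have "(tempered_kernel \<alpha> \<rho> t s *\<^sub>R (\<rho> *\<^sub>R ?w s + w' s)) $ i =
        exp (- \<rho> * t) * ((t - s) powr (- \<alpha>) * ml_series_deriv \<alpha> (c i) s)" for s
    proof -
      have "exp (- \<rho> * t) = exp (- \<rho> * (t - s)) * exp (- \<rho> * s)"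
        by (simp add: exp_add[symmetric] algebra_simps)
      then show ?thesis by (simp add: w'_def d_def tempered_kernel_def)
    qed
    ultimately show "((\<lambda>s. (tempered_kernel \<alpha> \<rho> t s *\<^sub>R (\<rho> *\<^sub>R ?w s + w' s)) $ i) has_integral
        (Gamma (1 - \<alpha>) *\<^sub>R (A *v ?w t)) $ i) {0..t}"
      by (simp add: Aw mult_ac)
  qed
  have "\<exists>y'. (\<forall>t\<in>{0<..T}. (?w has_vector_derivative y' t) (at t within {0..T})) \<and>
      continuous_on {0<..T} y' \<and> y' absolutely_integrable_on {0..T} \<and>
      (\<forall>t\<in>{0<..T}. ((\<lambda>s. tempered_kernel \<alpha> \<rho> t s *\<^sub>R (\<rho> *\<^sub>R ?w s + y' s)) has_integral
        Gamma (1 - \<alpha>) *\<^sub>R (A *v ?w t + B *v 0)) {0..t})"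
    by (rule exI[of _ w']) (use deriv cont_w' int_w' caputo in simp)
  then show ?thesis
    unfolding equation_solution_iff[OF \<alpha>(2)] using cont_w free_response_0[OF \<alpha>(1)] by blast
qed

lemma free_response_formula_solution:
  "formula_solution \<alpha> \<rho> T A B (\<lambda>_. 0) x (free_response \<alpha> \<rho> A x)"
  unfolding formula_solution_def free_response_def by (simp add: Let_def)

lemma free_response_unobservable:
  assumes "\<alpha> > 0" and "\<And>k. C *v (matpow A k *v x) = 0"
  shows "C *v free_response \<alpha> \<rho> A x t = 0"
  using assms by (simp add: vec_eq_iff free_response_output ml_series_def)

section \<open>Reconstruction of the initial state\<close>

lemma equation_solution_diff:
  assumes \<alpha>: "\<alpha> < 1"
    and 1: "equation_solution \<alpha> \<rho> T A B u1 x1 y1" and 2: "equation_solution \<alpha> \<rho> T A B u2 x2 y2"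
  shows "equation_solution \<alpha> \<rho> T A B (\<lambda>t. u1 t - u2 t) (x1 - x2) (\<lambda>t. y1 t - y2 t)"
proof -
  obtain y1' where y1: "continuous_on {0..T} y1" "y1 0 = x1"
      "\<And>t. t \<in> {0<..T} \<Longrightarrow> (y1 has_vector_derivative y1' t) (at t within {0..T})"
      "continuous_on {0<..T} y1'" "y1' absolutely_integrable_on {0..T}"
      "\<And>t. t \<in> {0<..T} \<Longrightarrow> ((\<lambda>s. tempered_kernel \<alpha> \<rho> t s *\<^sub>R (\<rho> *\<^sub>R y1 s + y1' s)) has_integral
        Gamma (1 - \<alpha>) *\<^sub>R (A *v y1 t + B *v u1 t)) {0..t}"
    using 1 unfolding equation_solution_iff[OF \<alpha>] by blast
  obtain y2' where y2: "continuous_on {0..T} y2" "y2 0 = x2"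
      "\<And>t. t \<in> {0<..T} \<Longrightarrow> (y2 has_vector_derivative y2' t) (at t within {0..T})"
      "continuous_on {0<..T} y2'" "y2' absolutely_integrable_on {0..T}"
      "\<And>t. t \<in> {0<..T} \<Longrightarrow> ((\<lambda>s. tempered_kernel \<alpha> \<rho> t s *\<^sub>R (\<rho> *\<^sub>R y2 s + y2' s)) has_integral
        Gamma (1 - \<alpha>) *\<^sub>R (A *v y2 t + B *v u2 t)) {0..t}"
    using 2 unfolding equation_solution_iff[OF \<alpha>] by blast
  have "((\<lambda>s. tempered_kernel \<alpha> \<rho> t s *\<^sub>R (\<rho> *\<^sub>R (y1 s - y2 s) + (y1' s - y2' s))) has_integral
        Gamma (1 - \<alpha>) *\<^sub>R (A *v (y1 t - y2 t) + B *v (u1 t - u2 t))) {0..t}" if "t \<in> {0<..T}" for t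
    using has_integral_diff[OF y1(6)[OF that] y2(6)[OF that]]
    by (simp add: algebra_simps matrix_vector_mult_diff_distrib)
  then have "\<exists>y'. (\<forall>t\<in>{0<..T}. ((\<lambda>t. y1 t - y2 t) has_vector_derivative y' t) (at t within {0..T})) \<and>
      continuous_on {0<..T} y' \<and> y' absolutely_integrable_on {0..T} \<and>
      (\<forall>t\<in>{0<..T}. ((\<lambda>s. tempered_kernel \<alpha> \<rho> t s *\<^sub>R (\<rho> *\<^sub>R (y1 s - y2 s) + y' s)) has_integral
        Gamma (1 - \<alpha>) *\<^sub>R (A *v (y1 t - y2 t) + B *v (u1 t - u2 t))) {0..t})"
    using y1 y2
    by (intro exI[of _ "\<lambda>t. y1' t - y2' t"])
      (simp add: has_vector_derivative_diff continuous_on_diff set_integral_diff(1))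
  then show ?thesis
    unfolding equation_solution_iff[OF \<alpha>] using y1(1,2) y2(1,2) by (simp add: continuous_on_diff)
qed

text \<open>If \<open>P w\<close> vanishes on an interval, then so does \<open>P w'\<close> inside it, hence also the Caputo derivative
  of \<open>w\<close> seen through \<open>P\<close>, which by the equation with zero input is \<open>P A w\<close>.  The
  endpoints follow by continuity, since the equation says nothing at \<open>t = 0\<close>.\<close>

lemma vanishing_output_propagates:
  fixes A :: "real ^ 'n ^ 'n" and P :: "real ^ 'n ^ 'p"
  assumes \<alpha>: "\<alpha> < 1" and tf: "0 < tf" "tf \<le> T"
    and sol: "equation_solution \<alpha> \<rho> T A B u x w"
    and u: "\<And>t. t \<in> {0..tf} \<Longrightarrow> u t = 0"
    and P: "\<And>t. t \<in> {0..tf} \<Longrightarrow> P *v w t = 0"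
    and t: "t \<in> {0..tf}"
  shows "P *v (A *v w t) = 0"
proof -
  obtain w' where w: "continuous_on {0..T} w"
      "\<And>t. t \<in> {0<..T} \<Longrightarrow> (w has_vector_derivative w' t) (at t within {0..T})"
      "\<And>t. t \<in> {0<..T} \<Longrightarrow> ((\<lambda>s. tempered_kernel \<alpha> \<rho> t s *\<^sub>R (\<rho> *\<^sub>R w s + w' s)) has_integral
        Gamma (1 - \<alpha>) *\<^sub>R (A *v w t + B *v u t)) {0..t}"
    using sol unfolding equation_solution_iff[OF \<alpha>] by blast
  have P': "P *v w' s = 0" if s: "s \<in> {0<..<tf}" for s
  proof -
    have "at s within {0..T} = at s"
      using s tf by (intro at_within_interior) auto
    then have "(w has_vector_derivative w' s) (at s)"
      using w(2)[of s] s tf by auto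
    then have "((\<lambda>s. P *v w s) has_vector_derivative P *v w' s) (at s)"
      by (rule bounded_linear.has_vector_derivative[OF matrix_vector_mul_bounded_linear])
    then have "((\<lambda>s. 0) has_vector_derivative P *v w' s) (at s)"
      by (rule has_vector_derivative_transform_within_open[OF _ open_greaterThanLessThan s])
        (use P in auto)
    then show ?thesis
      using has_vector_derivative_const vector_derivative_unique_at by blast
  qed
  have open_case: "P *v (A *v w t) = 0" if t: "t \<in> {0<..<tf}" for t
  proof -
    have "((\<lambda>s. P *v (tempered_kernel \<alpha> \<rho> t s *\<^sub>R (\<rho> *\<^sub>R w s + w' s))) has_integral
        P *v (Gamma (1 - \<alpha>) *\<^sub>R (A *v w t + B *v u t))) {0..t}"
      using has_integral_linear[OF w(3)[of t] matrix_vector_mul_bounded_linear[of P]] t tf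
      by (simp add: o_def)
    moreover have "((\<lambda>s. P *v (tempered_kernel \<alpha> \<rho> t s *\<^sub>R (\<rho> *\<^sub>R w s + w' s))) has_integral 0) {0..t}"
      by (rule has_integral_spike_finite[of "{0}" _ _ "\<lambda>_. 0"])
        (use t P P' in \<open>auto simp: matrix_vector_mult_scaleR matrix_vector_right_distrib\<close>)
    ultimately have "P *v (Gamma (1 - \<alpha>) *\<^sub>R (A *v w t + B *v u t)) = 0"
      by (rule has_integral_unique)
    moreover have "Gamma (1 - \<alpha>) > 0" using \<alpha> by (intro Gamma_real_pos) simp
    ultimately show ?thesis
      using u[of t] t by (simp add: matrix_vector_mult_scaleR)
  qed
  show ?thesis
  proof (rule continuous_constant_on_closure[of "{0<..<tf}" "\<lambda>t. P *v (A *v w t)"])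
    show "continuous_on (closure {0<..<tf}) (\<lambda>t. P *v (A *v w t))"
      unfolding matrix_vector_mul_assoc using tf
      by (auto intro!: bounded_linear.continuous_on[OF matrix_vector_mul_bounded_linear]
          continuous_on_subset[OF w(1)])
  qed (use open_case t tf in auto)
qed

text \<open>Iterating the previous lemma from \<open>P = C\<close> shows that \<open>C A\<^sup>k w\<close> vanishes for every \<open>k\<close>, in particular at
  time \<open>0\<close>.\<close>

lemma equation_solution_initial_state_zero:
  fixes A :: "real ^ 'n ^ 'n" and C :: "real ^ 'n ^ 'p"
  assumes \<alpha>: "\<alpha> < 1" and tf: "0 < tf" "tf \<le> T"
    and obs: "\<And>x. (\<And>k. C *v (matpow A k *v x) = 0) \<Longrightarrow> x = 0"
    and sol: "equation_solution \<alpha> \<rho> T A B u x w"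
    and u: "\<And>t. t \<in> {0..tf} \<Longrightarrow> u t = 0"
    and C: "\<And>t. t \<in> {0..tf} \<Longrightarrow> C *v w t = 0"
  shows "x = 0"
proof -
  have "C *v (matpow A k *v w t) = 0" if "t \<in> {0..tf}" for k t
    using that
  proof (induction k arbitrary: t)
    case (Suc k)
    then have "(C ** matpow A k) *v (A *v w t) = 0"
      by (intro vanishing_output_propagates[OF \<alpha> tf sol u]) (auto simp flip: matrix_vector_mul_assoc)
    then show ?case
      by (simp add: matpow_Suc_vector matrix_vector_mul_assoc[symmetric] del: matpow.simps)
  qed (simp add: C)
  then have "w 0 = 0" using tf by (intro obs) simp
  then show ?thesis using sol by (simp add: equation_solution_def)
qed

theorem theorem3p5:
  fixes \<alpha> \<rho> T tf :: real
    and A :: "real ^ 'n ^ 'n" and B :: "real ^ 'm ^ 'n"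
    and C :: "real ^ 'n ^ 'p" and D :: "real ^ 'm ^ 'p"
  assumes "\<rho> > 0" and "0 < \<alpha>" and "\<alpha> < 1" and "T > 0" and "0 < tf" and "tf \<le> T"
  shows "(observable_on tf (equation_solution \<alpha> \<rho> T A B) C D \<longleftrightarrow>
            rank (observability_matrix A C) = CARD('n)) \<and>
         (observable_on tf (formula_solution \<alpha> \<rho> T A B) C D \<longleftrightarrow>
            rank (observability_matrix A C) = CARD('n))"
proof -
  let ?obs = "\<forall>x. (\<forall>k. C *v (matpow A k *v x) = 0) \<longrightarrow> x = 0"
  \<comment> \<open>An unobservable state and the state \<open>0\<close> both produce the zero output under zero input.\<close>
  have necessary: "x = 0"
    if obs: "observable_on tf sol C D"
      and free: "\<And>x. sol (\<lambda>_. 0) x (free_response \<alpha> \<rho> A x)"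
      and x: "\<forall>k. C *v (matpow A k *v x) = 0"
    for sol :: "(real \<Rightarrow> real ^ 'm) \<Rightarrow> real ^ 'n \<Rightarrow> (real \<Rightarrow> real ^ 'n) \<Rightarrow> bool" and x
  proof -
    have "C *v free_response \<alpha> \<rho> A x t = 0" "C *v free_response \<alpha> \<rho> A 0 t = 0" for t
      by (rule free_response_unobservable; use x assms in simp)+
    then show ?thesis
      using obs[unfolded observable_on_def, rule_format, of "\<lambda>_. 0" x "free_response \<alpha> \<rho> A x"
          "\<lambda>_. 0" 0 "free_response \<alpha> \<rho> A 0"] free[of x] free[of 0]
      by simp
  qed
  have free_eq: "equation_solution \<alpha> \<rho> T A B (\<lambda>_. 0) x (free_response \<alpha> \<rho> A x)" for x
    by (rule free_response_equation_solution) (use assms in auto)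
  have eq: "observable_on tf (equation_solution \<alpha> \<rho> T A B) C D" if obs: ?obs
    unfolding observable_on_def
  proof (intro allI impI, elim conjE)
    fix u1 u2 x1 x2 y1 y2
    assume sol: "equation_solution \<alpha> \<rho> T A B u1 x1 y1" "equation_solution \<alpha> \<rho> T A B u2 x2 y2"
      and u: "\<forall>t\<in>{0..tf}. u1 t = u2 t"
      and z: "\<forall>t\<in>{0..tf}. C *v y1 t + D *v u1 t = C *v y2 t + D *v u2 t"
    have "x1 - x2 = 0"
    proof (rule equation_solution_initial_state_zero)
      show "equation_solution \<alpha> \<rho> T A B (\<lambda>t. u1 t - u2 t) (x1 - x2) (\<lambda>t. y1 t - y2 t)"
        by (rule equation_solution_diff[OF assms(3) sol])
      show "C *v (y1 t - y2 t) = 0" if "t \<in> {0..tf}" for t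
        using z u that by (simp add: matrix_vector_mult_diff_distrib)
      show "x = 0" if "\<And>k. C *v (matpow A k *v x) = 0" for x
        using obs that by blast
    qed (use assms u in simp_all)
    then show "x1 = x2" by simp
  qed
  have formula: "observable_on tf (formula_solution \<alpha> \<rho> T A B) C D" if obs: ?obs
    unfolding observable_on_def
  proof (intro allI impI, elim conjE)
    fix u1 u2 x1 x2 y1 y2
    assume sol: "formula_solution \<alpha> \<rho> T A B u1 x1 y1" "formula_solution \<alpha> \<rho> T A B u2 x2 y2"
      and u: "\<forall>t\<in>{0..tf}. u1 t = u2 t"
      and z: "\<forall>t\<in>{0..tf}. C *v y1 t + D *v u1 t = C *v y2 t + D *v u2 t"
    \<comment> \<open>The forcing integrals over \<open>[0, t]\<close> agree, so the difference is a free response, which solves the differential equation.\<close>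
    have diff: "y1 t - y2 t = free_response \<alpha> \<rho> A (x1 - x2) t" if t: "t \<in> {0..tf}" for t
    proof -
      let ?k = "\<lambda>u \<tau>. (exp (- \<rho> * (t - \<tau>)) * (t - \<tau>) powr (\<alpha> - 1)) *\<^sub>R
          (mittag_leffler2 \<alpha> \<alpha> ((t - \<tau>) powr \<alpha> *\<^sub>R A) *v (B *v u \<tau>))"
      have "integral {0..t} (?k u1) = integral {0..t} (?k u2)"
        using u t by (intro integral_cong) auto
      moreover have "t \<in> {0..T}" using t assms by auto
      ultimately show ?thesis
        using sol unfolding formula_solution_def Let_def free_response_def
        by (auto simp: matrix_vector_mult_diff_distrib scaleR_diff_right)
    qed
    have "C *v free_response \<alpha> \<rho> A (x1 - x2) t = 0" if "t \<in> {0..tf}" for t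
      using z u that unfolding diff[OF that, symmetric] by (simp add: matrix_vector_mult_diff_distrib)
    moreover have "x = 0" if "\<And>k. C *v (matpow A k *v x) = 0" for x
      using obs that by blast
    ultimately have "x1 - x2 = 0"
      by (rule equation_solution_initial_state_zero[OF assms(3,5,6) _ free_eq, rotated 2]) simp_all
    then show "x1 = x2" by simp
  qed
  have "observable_on tf (equation_solution \<alpha> \<rho> T A B) C D \<longleftrightarrow> ?obs"
    using necessary[of "equation_solution \<alpha> \<rho> T A B", OF _ free_eq] eq by blast
  moreover have "observable_on tf (formula_solution \<alpha> \<rho> T A B) C D \<longleftrightarrow> ?obs"
    using necessary[of "formula_solution \<alpha> \<rho> T A B", OF _ free_response_formula_solution] formula by blast
  ultimately show ?thesis
    unfolding rank_observability_matrix_full_iff by blast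
qed

end
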